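(* Let $\mathbf P=\mathbf P_n\in\mathbb R^{n\times n}$ be the t-SNE similarity matrix, let $R\ge1$ be the dimension of the null space of $\mathbf L(\mathbf P)$, and let $\mathbf U\in\mathbb R^{n\times R}$ have orthonormal columns forming a basis of the null space of $\mathbf L(\mathbf P)$. Suppose that $kh=o(n)$ and that for some constant $\kappa\in(0,1)$ the parameters $(\alpha,h)$ satisfy $$\kappa<h\lambda_{R+1}(\mathbf L(\alpha\mathbf P))\le h\lambda_n(\mathbf L(\alpha\mathbf P))<1 .$$ Then for nonzero $\mathbf y\in\mathbb R^n$, $$\lim_{k\to\infty}\frac{\big\|[\mathbf I_n-h\mathbf L(\alpha\mathbf P-\mathbf H_n)]^k\mathbf y-\mathbf U\mathbf U^\top\mathbf y\big\|_2}{\|\mathbf y\|_2}=0,$$ where $\mathbf H_n=\frac1{n(n-1)}(\mathbf 1_n\mathbf 1_n^\top-\mathbf I_n)$.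
   Context: For each $n\ge2$ there are data points $X_1,\dots,X_n\in\mathbb R^p$ and bandwidths $\tau_i>0$. The matrix $\mathbf P=(p_{ij})\in\mathbb R^{n\times n}$ is given by $p_{ii}=0$ and, for $i\ne j$, $p_{ij}=\frac{p_{i|j}+p_{j|i}}{2n}$ with $p_{j|i}=\frac{\exp(-\|X_i-X_j\|_2^2/2\tau_i^2)}{\sum_{\ell\ne i}\exp(-\|X_i-X_\ell\|_2^2/2\tau_i^2)}$. For symmetric $\mathbf A$, $\mathbf L(\mathbf A)=\mathbf D(\mathbf A)-\mathbf A$ with $\mathbf D(\mathbf A)=\mathrm{diag}(\sum_i a_{i1},\dots,\sum_i a_{in})$. Eigenvalues are ordered increasingly: $\lambda_1(\mathbf A)\le\dots\le\lambda_n(\mathbf A)$. $\mathbf 1_n$ is the all-ones vector. The parameters $\alpha>0$, $h>0$, the integer $k$, the matrix $\mathbf P$ and the vector $\mathbf y$ may depend on $n$, while $\kappa$ does not; the limit is along sequences with $n\to\infty$, $k=k_n\to\infty$ and $kh/n\to0$ (this is the meaning of $kh=o(n)$). *)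

theory Defs
  imports
    "HOL-Computational_Algebra.Polynomial"
    "Jordan_Normal_Form.Char_Poly"
    "Jordan_Normal_Form.Matrix_Kernel"
begin

text \<open>Points, matrix rows and matrix columns are indexed from 0, so a family of \<open>n\<close> points
  is a function whose values at \<open>{..<n}\<close> matter.\<close>

definition l2norm :: "real vec \<Rightarrow> real" where
  "l2norm v = sqrt (v \<bullet> v)"

definition gauss_kernel :: "(nat \<Rightarrow> real vec) \<Rightarrow> (nat \<Rightarrow> real) \<Rightarrow> nat \<Rightarrow> nat \<Rightarrow> real" where
  "gauss_kernel X \<tau> i j = exp (- (l2norm (X i - X j))\<^sup>2 / (2 * (\<tau> i)\<^sup>2))"

text \<open>\<open>cond_sim n X \<tau> i j\<close> is \<open>p\<^bsub>j|i\<^esub>\<close>: the conditioning point \<open>i\<close> comes first.\<close>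

definition cond_sim :: "nat \<Rightarrow> (nat \<Rightarrow> real vec) \<Rightarrow> (nat \<Rightarrow> real) \<Rightarrow> nat \<Rightarrow> nat \<Rightarrow> real" where
  "cond_sim n X \<tau> i j = gauss_kernel X \<tau> i j / (\<Sum>l\<in>{..<n} - {i}. gauss_kernel X \<tau> i l)"

definition tsne_sim :: "nat \<Rightarrow> (nat \<Rightarrow> real vec) \<Rightarrow> (nat \<Rightarrow> real) \<Rightarrow> real mat" where
  "tsne_sim n X \<tau> = mat n n (\<lambda>(i, j).
     if i = j then 0 else (cond_sim n X \<tau> j i + cond_sim n X \<tau> i j) / (2 * real n))"

definition degree_mat :: "real mat \<Rightarrow> real mat" where
  "degree_mat A = mat_diag (dim_col A) (\<lambda>j. \<Sum>i<dim_row A. A $$ (i, j))"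

definition laplacian :: "real mat \<Rightarrow> real mat" where
  "laplacian A = degree_mat A - A"

text \<open>The \<open>i\<close>-th smallest eigenvalue, counted with multiplicity and with \<open>i\<close> starting at 1.
  It is meaningful for a symmetric \<open>n \<times> n\<close> matrix and \<open>1 \<le> i \<le> n\<close>: then all \<open>n\<close> roots of the
  characteristic polynomial are real and algebraic and geometric multiplicities agree.\<close>

definition nth_eigenvalue :: "nat \<Rightarrow> real mat \<Rightarrow> real" where
  "nth_eigenvalue i A = sorted_list_of_multiset (proots (char_poly A)) ! (i - 1)"

definition H_mat :: "nat \<Rightarrow> real mat" where
  "H_mat n = (1 / (real n * (real n - 1))) \<cdot>\<^sub>m (mat n n (\<lambda>_. 1) - 1\<^sub>m n)"

definition orthonormal_null_basis :: "nat \<Rightarrow> nat \<Rightarrow> real mat \<Rightarrow> real mat \<Rightarrow> bool" where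
  "orthonormal_null_basis n r A U \<longleftrightarrow>
     U \<in> carrier_mat n r \<and>
     (\<forall>i<r. \<forall>j<r. col U i \<bullet> col U j = (if i = j then 1 else 0)) \<and>
     kernel.basis n A (set (cols U))"

end

theory Submission
  imports Defs "HOL-Analysis.L2_Norm" "Jordan_Normal_Form.Jordan_Normal_Form_Existence"
begin

text \<open>All off-diagonal similarities are positive, so the null space of \<open>L(P)\<close> consists of the constant
  vectors; hence \<open>R = 1\<close> and \<open>U U\<^sup>T\<close> is the averaging matrix \<open>J\<close> with entries \<open>1 / n\<close>. The step matrix
  \<open>M = I - h L(\<alpha> P - H)\<close> satisfies \<open>M J = J M = J\<close>, so \<open>M\<^sup>k - J = (M - J)\<^sup>k\<close> for \<open>k \<ge> 1\<close>. An eigenvector of \<open>M - J\<close>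
  for a nonzero eigenvalue is orthogonal to the constants, where \<open>h L(H)\<close> acts as \<open>h / (n - 1)\<close>, so
  the eigenvalue is \<open>1 + h / (n - 1) - h \<lambda>\<close> with \<open>\<lambda>\<close> a nonzero eigenvalue of \<open>L(\<alpha> P)\<close>. It lies
  between 0 and \<open>1 - \<kappa> / 2\<close> as soon as \<open>h / (n - 1) \<le> \<kappa> / 2\<close>, which gives the error bound
  \<open>(1 - \<kappa> / 2)\<^sup>k\<close>.\<close>

section \<open>Matrix-vector algebra and the Euclidean norm\<close>

lemma mult_mat_vec_index:
  assumes "A \<in> carrier_mat m n" "v \<in> carrier_vec n" "i < m"
  shows "(A *\<^sub>v v) $ i = (\<Sum>j<n. A $$ (i, j) * v $ j)"
  using assms by (simp add: scalar_prod_def atLeast0LessThan)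

lemma smult_mat_mult_vec:
  fixes A :: "'a :: comm_semiring_0 mat"
  assumes "A \<in> carrier_mat m n" "v \<in> carrier_vec n"
  shows "(c \<cdot>\<^sub>m A) *\<^sub>v v = c \<cdot>\<^sub>v (A *\<^sub>v v)"
  using assms by (intro eq_vecI) (auto simp: scalar_prod_def sum_distrib_left mult.assoc)

text \<open>Matrix powers append the new factor on the right; the iteration arguments need it on the
  left, as the last map applied.\<close>

lemma pow_mat_Suc_mult_vec:
  assumes "A \<in> carrier_mat n n" "v \<in> carrier_vec n"
  shows "A ^\<^sub>m Suc k *\<^sub>v v = A *\<^sub>v (A ^\<^sub>m k *\<^sub>v v)"
  using assms(2)
proof (induction k arbitrary: v)
  case 0
  then show ?case using assms(1) by simp
next
  case (Suc k)
  have c: "A ^\<^sub>m j \<in> carrier_mat n n" for j using assms(1) by simp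
  have Av: "A *\<^sub>v v \<in> carrier_vec n" using assms(1) Suc.prems by simp
  have "A ^\<^sub>m Suc (Suc k) *\<^sub>v v = A ^\<^sub>m Suc k *\<^sub>v (A *\<^sub>v v)"
    using assoc_mult_mat_vec[OF c assms(1) Suc.prems, of "Suc k"] by simp
  also have "\<dots> = A *\<^sub>v (A ^\<^sub>m k *\<^sub>v (A *\<^sub>v v))"
    by (rule Suc.IH[OF Av])
  also have "\<dots> = A *\<^sub>v (A ^\<^sub>m Suc k *\<^sub>v v)"
    using assoc_mult_mat_vec[OF c assms(1) Suc.prems, of k] by simp
  finally show ?case .
qed

lemma l2norm_conv_L2_set:
  assumes "v \<in> carrier_vec n"
  shows "l2norm v = L2_set (($) v) {..<n}"
  using assms by (auto simp: l2norm_def L2_set_def scalar_prod_def power2_eq_square atLeast0LessThan)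

lemma l2norm_nonneg: "0 \<le> l2norm v"
  by (auto simp: l2norm_def scalar_prod_def intro!: sum_nonneg)

lemma l2norm_sq: "(l2norm v)\<^sup>2 = v \<bullet> v"
  unfolding l2norm_def by (auto simp: scalar_prod_def intro!: sum_nonneg)

lemma l2norm_pos:
  assumes "v \<in> carrier_vec n" "v \<noteq> 0\<^sub>v n"
  shows "0 < l2norm v"
proof -
  have "l2norm v \<noteq> 0"
    using assms by (auto simp: l2norm_conv_L2_set L2_set_eq_0_iff)
  then show ?thesis using l2norm_nonneg[of v] by linarith
qed

lemma l2norm_smult:
  assumes "v \<in> carrier_vec n"
  shows "l2norm (c \<cdot>\<^sub>v v) = \<bar>c\<bar> * l2norm v"
  using assms by (simp add: l2norm_def real_sqrt_mult)

lemma scalar_prod_le_l2norm: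
  assumes "v \<in> carrier_vec n" "w \<in> carrier_vec n"
  shows "v \<bullet> w \<le> l2norm v * l2norm w"
proof -
  have "v \<bullet> w \<le> (\<Sum>i<n. \<bar>v $ i\<bar> * \<bar>w $ i\<bar>)"
    using assms unfolding scalar_prod_def
    by (auto simp: atLeast0LessThan abs_mult[symmetric] intro!: sum_mono)
  also have "\<dots> \<le> l2norm v * l2norm w"
    using L2_set_mult_ineq assms by (simp add: l2norm_conv_L2_set)
  finally show ?thesis .
qed

section \<open>Spectra of real symmetric matrices\<close>

lemma symmetric_scalar_prod:
  fixes A :: "'a :: comm_semiring_0 mat"
  assumes "A \<in> carrier_mat n n" "A\<^sup>T = A" "x \<in> carrier_vec n" "y \<in> carrier_vec n"
  shows "(A *\<^sub>v y) \<bullet> x = y \<bullet> (A *\<^sub>v x)"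
  using transpose_vec_mult_scalar[OF assms(1,3,4)] assms(2) by simp

lemma symmetric_index:
  assumes "A \<in> carrier_mat n n" "A\<^sup>T = A" "i < n" "j < n"
  shows "A $$ (i, j) = A $$ (j, i)"
  using assms by (metis carrier_matD index_transpose_mat(1))

lemma symmetricI:
  assumes "A \<in> carrier_mat n n" "\<And>i j. i < n \<Longrightarrow> j < n \<Longrightarrow> A $$ (i, j) = A $$ (j, i)"
  shows "A\<^sup>T = A"
  using assms by (intro eq_matI) auto

text \<open>Moving the symmetric matrix across \<open>v \<bullet> conjugate v\<close> evaluates the
  same product once with factor \<open>a\<close> and once with \<open>cnj a\<close>; the product is
  nonzero for an eigenvector.\<close>

lemma symmetric_complex_eigenvalue_real:
  fixes A :: "real mat"
  assumes A: "A \<in> carrier_mat n n" "A\<^sup>T = A"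
    and ev: "eigenvalue (map_mat complex_of_real A) a"
  shows "a \<in> \<real>"
proof -
  let ?C = "map_mat complex_of_real A"
  have C: "?C \<in> carrier_mat n n" using A by simp
  have Ct: "?C\<^sup>T = ?C"
    using A symmetric_index[OF A] by (intro symmetricI[OF C]) simp
  obtain v where v: "v \<in> carrier_vec n" "v \<noteq> 0\<^sub>v n" "?C *\<^sub>v v = a \<cdot>\<^sub>v v"
    using ev A unfolding eigenvalue_def eigenvector_def by auto
  have cv: "conjugate v \<in> carrier_vec n" using v by simp
  have "?C *\<^sub>v conjugate v = conjugate (?C *\<^sub>v v)"
    using v(1) A by (intro eq_vecI) (auto simp: scalar_prod_def conjugate_complex_def)
  also have "\<dots> = cnj a \<cdot>\<^sub>v conjugate v"
    unfolding v(3) by (simp add: conjugate_smult_vec conjugate_complex_def)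
  finally have cC: "?C *\<^sub>v conjugate v = cnj a \<cdot>\<^sub>v conjugate v" .
  have "a * (v \<bullet> conjugate v) = (?C *\<^sub>v v) \<bullet> conjugate v"
    using v cv by simp
  also have "\<dots> = v \<bullet> (?C *\<^sub>v conjugate v)"
    by (rule symmetric_scalar_prod[OF C Ct cv v(1)])
  also have "\<dots> = cnj a * (v \<bullet> conjugate v)"
    unfolding cC using v cv by simp
  finally have "a = cnj a"
    using conjugate_square_eq_0_vec[OF v(1)] v(2) by simp
  then show ?thesis by (simp add: complex_is_Real_iff complex_eq_iff)
qed

text \<open>Over the complex numbers the polynomial splits, and all its roots are real; injectivity
  of the embedding of real polynomials brings the factorization back.\<close>

lemma symmetric_char_poly_splits:
  fixes A :: "real mat"
  assumes A: "A \<in> carrier_mat n n" "A\<^sup>T = A"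
  obtains es where "char_poly A = (\<Prod>e\<leftarrow>es. [:- e, 1:])" "length es = n"
proof -
  let ?C = "map_mat complex_of_real A"
  have C: "?C \<in> carrier_mat n n" using A by simp
  obtain as where as: "char_poly ?C = (\<Prod>a\<leftarrow>as. [:- a, 1:])" "length as = n"
    using char_poly_factorized[OF C] by auto
  have real: "complex_of_real (Re a) = a" if "a \<in> set as" for a
  proof -
    have "poly (char_poly ?C) a = 0" unfolding as(1) by (rule linear_poly_root[OF that])
    then have "eigenvalue ?C a" using eigenvalue_root_char_poly[OF C] by simp
    then show ?thesis using symmetric_complex_eigenvalue_real[OF A] by simp
  qed
  interpret h: map_poly_inj_idom_hom complex_of_real ..
  have *: "map_poly complex_of_real (\<Prod>e\<leftarrow>xs. [:- e, 1:])
      = (\<Prod>e\<leftarrow>map complex_of_real xs. [:- e, 1:])" for xs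
    by (induction xs) (simp_all add: h.hom_mult del: mult_pCons_left)
  have "map complex_of_real (map Re as) = as"
    using real by (simp add: map_idI)
  then have "map_poly complex_of_real (char_poly A)
      = map_poly complex_of_real (\<Prod>e\<leftarrow>map Re as. [:- e, 1:])"
    unfolding * of_real_hom.char_poly_hom[OF A(1), symmetric] as(1) by (metis)
  then have "char_poly A = (\<Prod>e\<leftarrow>map Re as. [:- e, 1:])"
    using h.eq_iff by blast
  from that[OF this] as(2) show thesis by simp
qed

section \<open>Contraction from eigenvalue bounds\<close>

lemma symmetric_pow_bounded:
  fixes A :: "real mat"
  assumes A: "A \<in> carrier_mat n n" "A\<^sup>T = A"
    and ev: "\<And>e. eigenvalue A e \<Longrightarrow> \<bar>e\<bar> < 1"
    and x: "x \<in> carrier_vec n"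
  obtains K where "\<And>m. l2norm (A ^\<^sub>m m *\<^sub>v x) \<le> K"
proof -
  obtain es where es: "char_poly A = (\<Prod>e\<leftarrow>es. [:- e, 1:])"
    using symmetric_char_poly_splits[OF A] .
  have lt: "norm e < 1" if "e \<in> set es" for e
  proof -
    have "poly (char_poly A) e = 0" unfolding es by (rule linear_poly_root[OF that])
    then show ?thesis using ev eigenvalue_root_char_poly[OF A(1)] by simp
  qed
  \<comment> \<open>The multiplicity bound for roots of modulus 1 can be 0, as there are none.
    Truncated subtraction makes the exponent \<open>0 - 1\<close> zero, so the bound is constant in
    \<open>k\<close>.\<close>
  have "\<exists>c1 c2. \<forall>k. norm_bound (A ^\<^sub>m k) (c1 + c2 * of_nat k ^ (0 - 1))"
    by (rule factored_char_poly_norm_bound_cof[OF A(1) es]) (use lt in force)+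
  then obtain c where c: "\<And>k. norm_bound (A ^\<^sub>m k) c" by auto
  have "l2norm (A ^\<^sub>m m *\<^sub>v x) \<le> (\<Sum>i<n. \<Sum>j<n. c * \<bar>x $ j\<bar>)" for m
  proof -
    have P: "A ^\<^sub>m m \<in> carrier_mat n n" using A by simp
    have "l2norm (A ^\<^sub>m m *\<^sub>v x) \<le> (\<Sum>i<n. \<bar>(A ^\<^sub>m m *\<^sub>v x) $ i\<bar>)"
      using P x by (subst l2norm_conv_L2_set[of _ n]) (auto intro: L2_set_le_sum_abs)
    also have "\<dots> \<le> (\<Sum>i<n. \<Sum>j<n. c * \<bar>x $ j\<bar>)"
    proof (rule sum_mono)
      fix i assume i: "i \<in> {..<n}"
      have "\<bar>(A ^\<^sub>m m *\<^sub>v x) $ i\<bar> \<le> (\<Sum>j<n. \<bar>(A ^\<^sub>m m) $$ (i, j) * x $ j\<bar>)"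
        using i by (simp add: mult_mat_vec_index[OF P x] sum_abs del: index_mult_mat_vec)
      also have "\<dots> \<le> (\<Sum>j<n. c * \<bar>x $ j\<bar>)"
        using c[of m] i P A
        by (intro sum_mono) (auto simp: abs_mult norm_bound_def intro!: mult_right_mono)
      finally show "\<bar>(A ^\<^sub>m m *\<^sub>v x) $ i\<bar> \<le> (\<Sum>j<n. c * \<bar>x $ j\<bar>)" .
    qed
    finally show ?thesis .
  qed
  then show thesis using that by blast
qed

text \<open>Log-convexity makes successive ratios nondecreasing, so a first ratio above 1 would
  force geometric growth beyond \<open>K\<close>.\<close>

lemma log_convex_bounded:
  fixes a :: "nat \<Rightarrow> real"
  assumes nonneg: "\<And>m. 0 \<le> a m"
    and convex: "\<And>m. (a (Suc m))\<^sup>2 \<le> a m * a (Suc (Suc m))"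
    and bounded: "\<And>m. a m \<le> K"
  shows "a 1 \<le> a 0"
proof (rule ccontr)
  assume "\<not> a 1 \<le> a 0"
  then have gt: "a 0 < a 1" by simp
  \<comment> \<open>If \<open>a 0\<close> were 0, convexity at 0 would give
    \<open>(a 1)\<^sup>2 \<le> 0\<close>, against \<open>a 0 < a 1\<close>.\<close>
  have "0 < a 0"
    using convex[of 0] gt nonneg[of 0] by (cases "a 0 = 0") auto
  define r where "r = a 1 / a 0"
  have r: "1 < r" using gt \<open>0 < a 0\<close> by (simp add: r_def)
  have step: "0 < a m \<and> r * a m \<le> a (Suc m)" for m
  proof (induction m)
    case 0
    then show ?case using \<open>0 < a 0\<close> by (simp add: r_def)
  next
    case (Suc m)
    then have pos: "0 < a (Suc m)" using r by (smt (verit) mult_pos_pos)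
    have "(r * a (Suc m)) * a m \<le> a (Suc m) * a (Suc m)"
      using mult_left_mono[of "r * a m" "a (Suc m)" "a (Suc m)"] Suc pos by (simp add: ac_simps)
    also have "\<dots> \<le> a (Suc (Suc m)) * a m"
      using convex[of m] by (simp add: power2_eq_square ac_simps)
    finally show ?case using Suc pos by simp
  qed
  have pow: "r ^ m * a 0 \<le> a m" for m
  proof (induction m)
    case (Suc m)
    have "r ^ Suc m * a 0 \<le> r * a m" using Suc r by (simp add: mult.assoc)
    then show ?case using step[of m] by linarith
  qed simp
  obtain m where "K / a 0 < r ^ m" using real_arch_pow[OF r] by blast
  then have "K < r ^ m * a 0" using \<open>0 < a 0\<close> by (simp add: divide_simps)
  then show False using pow[of m] bounded[of m] by linarith
qed

text \<open>For symmetric \<open>A\<close> the sequence \<open>m \<mapsto> l2norm (A ^\<^sub>m m *\<^sub>v x)\<close> is log-convex by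
  Cauchy-Schwarz, so boundedness of the powers already forces a contraction in the first step.\<close>

lemma symmetric_contraction_aux:
  fixes A :: "real mat"
  assumes A: "A \<in> carrier_mat n n" "A\<^sup>T = A"
    and ev: "\<And>e. eigenvalue A e \<Longrightarrow> \<bar>e\<bar> < 1"
    and x: "x \<in> carrier_vec n"
  shows "l2norm (A *\<^sub>v x) \<le> l2norm x"
proof -
  obtain K where K: "\<And>m. l2norm (A ^\<^sub>m m *\<^sub>v x) \<le> K"
    using symmetric_pow_bounded[OF A ev x] by blast
  let ?w = "\<lambda>m. A ^\<^sub>m m *\<^sub>v x"
  have w: "?w m \<in> carrier_vec n" for m 
    using A x by (meson mult_mat_vec_carrier pow_carrier_mat)
  have "(l2norm (?w (Suc m)))\<^sup>2 \<le> l2norm (?w m) * l2norm (?w (Suc (Suc m)))" for m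
  proof -
    have "(l2norm (?w (Suc m)))\<^sup>2 = (A *\<^sub>v ?w m) \<bullet> ?w (Suc m)"
      unfolding l2norm_sq pow_mat_Suc_mult_vec[OF A(1) x] ..
    \<comment> \<open>Symmetry moves one factor \<open>A\<close> to the other argument, which
      spreads the exponents to \<open>m\<close> and \<open>m + 2\<close>.\<close>
    also have "\<dots> = ?w m \<bullet> ?w (Suc (Suc m))"
      using symmetric_scalar_prod[OF A w w] pow_mat_Suc_mult_vec[OF A(1) x, of "Suc m"] by metis
    also have "\<dots> \<le> l2norm (?w m) * l2norm (?w (Suc (Suc m)))"
      by (rule scalar_prod_le_l2norm[OF w w])
    finally show ?thesis .
  qed
  from log_convex_bounded[of "\<lambda>m. l2norm (?w m)", OF l2norm_nonneg this K]
  show ?thesis using A x by simp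
qed

text \<open>Dividing \<open>A\<close> by \<open>\<rho>\<close> puts its spectrum strictly inside the
  unit interval and reduces the claim to the preceding lemma.\<close>

lemma symmetric_contraction:
  fixes A :: "real mat"
  assumes A: "A \<in> carrier_mat n n" "A\<^sup>T = A"
    and ev: "\<And>e. eigenvalue A e \<Longrightarrow> \<bar>e\<bar> < \<rho>" and \<rho>: "0 < \<rho>"
    and x: "x \<in> carrier_vec n"
  shows "l2norm (A *\<^sub>v x) \<le> \<rho> * l2norm x"
proof -
  let ?B = "(1 / \<rho>) \<cdot>\<^sub>m A"
  have B: "?B \<in> carrier_mat n n" using A(1) by simp
  have Bt: "?B\<^sup>T = ?B"
    using A symmetric_index[OF A] by (intro symmetricI[OF B]) simp
  have "\<bar>e\<bar> < 1" if e: "eigenvalue ?B e" for e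
  proof -
    obtain v where v: "v \<in> carrier_vec n" "v \<noteq> 0\<^sub>v n" "?B *\<^sub>v v = e \<cdot>\<^sub>v v"
      using e A unfolding eigenvalue_def eigenvector_def by auto
    have "A *\<^sub>v v = \<rho> \<cdot>\<^sub>v (?B *\<^sub>v v)"
      using \<rho> A v(1) by (simp add: smult_mat_mult_vec smult_smult_assoc)
    also have "\<dots> = (\<rho> * e) \<cdot>\<^sub>v v" unfolding v(3) by (simp add: smult_smult_assoc)
    finally have "eigenvalue A (\<rho> * e)"
      using v A unfolding eigenvalue_def eigenvector_def by auto
    from ev[OF this] \<rho> show ?thesis by (simp add: abs_mult)
  qed
  from symmetric_contraction_aux[OF B Bt this x]
  have "l2norm ((1 / \<rho>) \<cdot>\<^sub>v (A *\<^sub>v x)) \<le> l2norm x"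
    using A x by (simp add: smult_mat_mult_vec)
  then show ?thesis
    using \<rho> A x by (subst (asm) l2norm_smult[of _ n]) (auto simp: field_simps)
qed

lemma symmetric_pow_contraction:
  fixes A :: "real mat"
  assumes A: "A \<in> carrier_mat n n" "A\<^sup>T = A"
    and ev: "\<And>e. eigenvalue A e \<Longrightarrow> \<bar>e\<bar> < \<rho>" and \<rho>: "0 < \<rho>"
    and x: "x \<in> carrier_vec n"
  shows "l2norm (A ^\<^sub>m k *\<^sub>v x) \<le> \<rho> ^ k * l2norm x"
proof (induction k)
  case 0
  then show ?case using A x by simp
next
  case (Suc k)
  have w: "A ^\<^sub>m k *\<^sub>v x \<in> carrier_vec n"
    using A x by (meson mult_mat_vec_carrier pow_carrier_mat)
  have "l2norm (A ^\<^sub>m Suc k *\<^sub>v x) \<le> \<rho> * l2norm (A ^\<^sub>m k *\<^sub>v x)"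
    unfolding pow_mat_Suc_mult_vec[OF A(1) x] by (rule symmetric_contraction[OF A ev \<rho> w])
  also have "\<dots> \<le> \<rho> ^ Suc k * l2norm x"
    using mult_left_mono[OF Suc, of \<rho>] \<rho> by (simp add: mult.assoc)
  finally show ?case .
qed

text \<open>Since the second smallest eigenvalue is positive, the eigenvalue 0 can only occupy
  position 0 of the sorted list. A nonzero eigenvalue therefore sits at position 1, which is
  \<open>nth_eigenvalue 2 A\<close>, or later.\<close>

lemma symmetric_nonzero_eigenvalue_bounds:
  fixes A :: "real mat"
  assumes A: "A \<in> carrier_mat n n" "A\<^sup>T = A"
    and zero: "eigenvalue A 0" and pos: "0 < nth_eigenvalue 2 A"
    and e: "eigenvalue A e" "e \<noteq> 0"
  shows "nth_eigenvalue 2 A \<le> e" "e \<le> nth_eigenvalue n A"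
proof -
  obtain es where es: "char_poly A = (\<Prod>e\<leftarrow>es. [:- e, 1:])" "length es = n"
    using symmetric_char_poly_splits[OF A] .
  have "proots (\<Prod>e\<leftarrow>xs. [:- e, 1:]) = mset xs" for xs :: "real list"
  proof (induction xs)
    case (Cons x xs)
    have "(\<Prod>e\<leftarrow>xs. [:- e, 1:]) \<noteq> 0" by (auto simp: prod_list_zero_iff)
    then show ?case using Cons by (simp add: proots_mult del: mult_pCons_left)
  qed simp
  then have nth: "nth_eigenvalue i A = sort es ! (i - 1)" for i
    unfolding nth_eigenvalue_def es(1) by simp
  have mem: "\<exists>i<n. sort es ! i = a" if "eigenvalue A a" for a
  proof -
    have "poly (\<Prod>e\<leftarrow>es. [:- e, 1:]) a = 0"
      using that eigenvalue_root_char_poly[OF A(1)] es(1) by simp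
    then have "a \<in> set (sort es)" by (auto simp: poly_prod_list prod_list_zero_iff)
    then show ?thesis using es(2) by (metis in_set_conv_nth length_sort)
  qed
  have mono: "sort es ! i \<le> sort es ! j" if "i \<le> j" "j < n" for i j
    using that es(2) by (intro sorted_nth_mono) auto
  obtain i0 where i0: "i0 < n" "sort es ! i0 = 0" using mem[OF zero] by blast
  obtain i where i: "i < n" "sort es ! i = e" using mem[OF e(1)] by blast
  have "i0 = 0" using pos mono[of 1 i0] i0 unfolding nth by (cases "i0 = 0") auto
  then have "i \<noteq> 0" using i i0 e(2) by metis
  then show "nth_eigenvalue 2 A \<le> e" using mono[of 1 i] i unfolding nth by auto
  show "e \<le> nth_eigenvalue n A" using mono[of i "n - 1"] i unfolding nth by auto
qed

section \<open>Laplacians of symmetric weight matrices\<close>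

lemma laplacian_carrier:
  "A \<in> carrier_mat n n \<Longrightarrow> laplacian A \<in> carrier_mat n n"
  by (auto simp: laplacian_def degree_mat_def)

lemma laplacian_index:
  assumes "A \<in> carrier_mat n n" "i < n" "j < n"
  shows "laplacian A $$ (i, j) = (if i = j then \<Sum>l<n. A $$ (l, i) else 0) - A $$ (i, j)"
  using assms by (auto simp: laplacian_def degree_mat_def mat_diag_def)

lemma laplacian_symmetric:
  assumes A: "A \<in> carrier_mat n n" "A\<^sup>T = A"
  shows "(laplacian A)\<^sup>T = laplacian A"
  using symmetric_index[OF A] A(1)
  by (intro symmetricI[OF laplacian_carrier[OF A(1)]]) (simp add: laplacian_index)

text \<open>In this difference form the diagonal of \<open>A\<close> drops out, constants are
  visibly annihilated, and signs can be read off at a maximal entry.\<close>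

lemma laplacian_mult_vec:
  assumes A: "A \<in> carrier_mat n n" "A\<^sup>T = A" and x: "x \<in> carrier_vec n" and i: "i < n"
  shows "(laplacian A *\<^sub>v x) $ i = (\<Sum>j<n. A $$ (i, j) * (x $ i - x $ j))"
proof -
  have "(laplacian A *\<^sub>v x) $ i
      = (\<Sum>j<n. (if i = j then (\<Sum>l<n. A $$ (l, i)) * x $ j else 0) - A $$ (i, j) * x $ j)"
    unfolding mult_mat_vec_index[OF laplacian_carrier[OF A(1)] x i]
    using A i by (intro sum.cong) (auto simp: laplacian_index left_diff_distrib)
  also have "\<dots> = (\<Sum>l<n. A $$ (l, i)) * x $ i - (\<Sum>j<n. A $$ (i, j) * x $ j)"
    using i by (simp add: sum_subtractf)
  also have "(\<Sum>l<n. A $$ (l, i)) = (\<Sum>l<n. A $$ (i, l))"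
    using symmetric_index[OF A] i by simp
  finally show ?thesis
    by (simp add: right_diff_distrib sum_subtractf sum_distrib_right)
qed

text \<open>Maximum principle: the row of \<open>laplacian A\<close> at a largest entry of \<open>x\<close> gives a sum of
  nonnegative terms that vanishes.\<close>

lemma laplacian_kernel_const:
  assumes A: "A \<in> carrier_mat n n" "A\<^sup>T = A"
    and pos: "\<And>i j. i < n \<Longrightarrow> j < n \<Longrightarrow> i \<noteq> j \<Longrightarrow> 0 < A $$ (i, j)"
    and x: "x \<in> carrier_vec n" "laplacian A *\<^sub>v x = 0\<^sub>v n"
    and ij: "i < n" "j < n"
  shows "x $ i = x $ j"
proof -
  obtain m where m: "m < n" "\<And>l. l < n \<Longrightarrow> x $ l \<le> x $ m"
  proof -
    have "Max ((($) x) ` {..<n}) \<in> (($) x) ` {..<n}"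
      using ij by (intro Max_in) auto
    then obtain m where "m < n" "Max ((($) x) ` {..<n}) = x $ m" by auto
    moreover have "x $ l \<le> Max ((($) x) ` {..<n})" if "l < n" for l
      using that by (intro Max_ge) auto
    ultimately show thesis using that by simp
  qed
  have nonneg: "0 \<le> A $$ (m, l) * (x $ m - x $ l)" if "l < n" for l
    using pos[of m l] m that by (cases "l = m") (auto intro!: mult_nonneg_nonneg less_imp_le)
  have "(\<Sum>l<n. A $$ (m, l) * (x $ m - x $ l)) = 0"
    using laplacian_mult_vec[OF A x(1) m(1)] x(2) m(1) by simp
  then have zero: "A $$ (m, l) * (x $ m - x $ l) = 0" if "l < n" for l
    using nonneg that by (subst (asm) sum_nonneg_eq_0_iff) auto
  have "x $ l = x $ m" if "l < n" for l
    using zero[OF that] pos[of m l] m(1) that by (cases "l = m") auto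
  then show ?thesis using ij by simp
qed

section \<open>The similarity matrix and the projection onto its null space\<close>

lemma tsne_sim_carrier: "tsne_sim n X \<tau> \<in> carrier_mat n n"
  by (simp add: tsne_sim_def)

lemma tsne_sim_symmetric: "(tsne_sim n X \<tau>)\<^sup>T = tsne_sim n X \<tau>"
  by (rule symmetricI[OF tsne_sim_carrier]) (simp add: tsne_sim_def add.commute)

lemma tsne_sim_pos:
  assumes "i < n" "j < n" "i \<noteq> j"
  shows "0 < tsne_sim n X \<tau> $$ (i, j)"
proof -
  have "0 < cond_sim n X \<tau> a b" if "a < n" "b < n" "a \<noteq> b" for a b
    unfolding cond_sim_def using that
    by (intro divide_pos_pos sum_pos) (auto simp: gauss_kernel_def)
  then show ?thesis using assms by (simp add: tsne_sim_def add_pos_pos)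
qed

text \<open>The columns of \<open>U\<close> are constant vectors, and two nonzero constant vectors
  are never orthogonal. A single column remains, and its normalization makes the square of its
  common entry \<open>1 / real n\<close>.\<close>

lemma orthonormal_null_basis_const:
  assumes A: "A \<in> carrier_mat n n" and n: "0 < n" and r: "1 \<le> r"
    and U: "orthonormal_null_basis n r A U"
    and const: "\<And>x i j. x \<in> carrier_vec n \<Longrightarrow> A *\<^sub>v x = 0\<^sub>v n \<Longrightarrow> i < n \<Longrightarrow> j < n \<Longrightarrow> x $ i = x $ j"
  shows "r = 1" "U * U\<^sup>T = mat n n (\<lambda>_. 1 / real n)"
proof -
  interpret kernel n n A by unfold_locales (rule A)
  have Uc: "U \<in> carrier_mat n r"
    and orth: "\<And>i j. i < r \<Longrightarrow> j < r \<Longrightarrow> col U i \<bullet> col U j = (if i = j then 1 else 0)"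
    using U unfolding orthonormal_null_basis_def by auto
  have ker: "set (cols U) \<subseteq> mat_kernel A"
    using U unfolding orthonormal_null_basis_def Ker.basis_def by auto
  have row: "U $$ (i, j) = U $$ (0, j)" if "i < n" "j < r" for i j
  proof -
    have "col U j \<in> mat_kernel A" using ker that Uc by (auto simp: cols_def)
    then have "A *\<^sub>v col U j = 0\<^sub>v n" "col U j \<in> carrier_vec n"
      using A by (auto simp: mat_kernel_def)
    from const[OF this(2,1) that(1) n] show ?thesis using that Uc n by simp
  qed
  \<comment> \<open>For constant columns, orthonormality is a relation between their entries in row
    0 alone.\<close>
  have prod: "real n * (U $$ (0, i) * U $$ (0, j)) = (if i = j then 1 else 0)"
    if "i < r" "j < r" for i j
  proof -
    have "col U i \<bullet> col U j = (\<Sum>l<n. U $$ (l, i) * U $$ (l, j))"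
      using that Uc by (simp add: scalar_prod_def atLeast0LessThan)
    also have "\<dots> = (\<Sum>l<n. U $$ (0, i) * U $$ (0, j))"
      using that by (intro sum.cong refl arg_cong2[of _ _ _ _ times] row) auto
    finally show ?thesis using orth[OF that] by simp
  qed
  show r1: "r = 1"
  proof (rule ccontr)
    assume "r \<noteq> 1"
    then have "1 < r" using r by simp
    then show False using prod[of 0 0] prod[of 1 1] prod[of 0 1] by auto
  qed
  show "U * U\<^sup>T = mat n n (\<lambda>_. 1 / real n)"
  proof (rule eq_matI)
    fix i j assume "i < dim_row (mat n n (\<lambda>_. 1 / real n))" "j < dim_col (mat n n (\<lambda>_. 1 / real n))"
    then have ij: "i < n" "j < n" by auto
    have "(U * U\<^sup>T) $$ (i, j) = U $$ (i, 0) * U $$ (j, 0)"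
      using ij Uc r1 by (simp add: scalar_prod_def)
    also have "\<dots> = U $$ (0, 0) * U $$ (0, 0)" using row[OF ij(1), of 0] row[OF ij(2), of 0] r1 by simp
    also have "\<dots> = 1 / real n" using prod[of 0 0] n r1 by (simp add: field_simps)
    finally show "(U * U\<^sup>T) $$ (i, j) = mat n n (\<lambda>_. 1 / real n) $$ (i, j)" using ij by simp
  qed (use Uc in auto)
qed

section \<open>Deflation and the step matrix\<close>

text \<open>Every mixed product of powers of \<open>M\<close> with \<open>J\<close> collapses to
  \<open>J\<close>, so only one copy of \<open>J\<close> survives. The exponent is a successor
  because at exponent 0 the left side is the identity.\<close>

lemma deflation_pow:
  fixes M J :: "'a :: ring_1 mat"
  assumes M: "M \<in> carrier_mat n n" and J: "J \<in> carrier_mat n n"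
    and MJ: "M * J = J" and JM: "J * M = J" and JJ: "J * J = J"
  shows "(M - J) ^\<^sub>m Suc k = M ^\<^sub>m Suc k - J"
proof (induction k)
  case 0
  then show ?case using M J by (simp add: minus_carrier_mat)
next
  case (Suc k)
  have Mk: "M ^\<^sub>m j \<in> carrier_mat n n" for j using M by simp
  have MkJ: "M ^\<^sub>m j * J = J" for j
  proof (induction j)
    case (Suc j)
    then show ?case using assoc_mult_mat[OF Mk[of j] M J] MJ by simp
  qed (use M J in simp)
  have MJc: "M - J \<in> carrier_mat n n" using J by (rule minus_carrier_mat)
  have "(M - J) ^\<^sub>m Suc (Suc k) = (M ^\<^sub>m Suc k - J) * (M - J)"
    using Suc by simp
  also have "\<dots> = M ^\<^sub>m Suc k * (M - J) - J * (M - J)"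
    by (rule minus_mult_distrib_mat[OF Mk J MJc])
  also have "J * (M - J) = 0\<^sub>m n n"
    unfolding mult_minus_distrib_mat[OF J M J] JM JJ using J by simp
  also have "M ^\<^sub>m Suc k * (M - J) = M ^\<^sub>m Suc (Suc k) - J"
    unfolding mult_minus_distrib_mat[OF Mk M J] MkJ by simp
  also have "M ^\<^sub>m Suc (Suc k) - J - 0\<^sub>m n n = M ^\<^sub>m Suc (Suc k) - J"
    using J M by (intro eq_matI) auto
  finally show ?case .
qed

lemma minus_H_mat_carrier: "A - H_mat n \<in> carrier_mat n n"
  by (intro carrier_matI) (simp_all add: H_mat_def)

lemma minus_H_mat_symmetric:
  assumes A: "A \<in> carrier_mat n n" "A\<^sup>T = A"
  shows "(A - H_mat n)\<^sup>T = A - H_mat n"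
  using A symmetric_index[OF A]
  by (intro symmetricI[OF minus_H_mat_carrier]) (simp add: H_mat_def)

text \<open>The Laplacian is linear in the weights, and that of \<open>H_mat n\<close> sends
  \<open>x\<close> to its deviation from the mean divided by \<open>n - 1\<close>.\<close>

lemma exaggeration_mult_vec:
  fixes A :: "real mat" and h :: real
  assumes A: "A \<in> carrier_mat n n" "A\<^sup>T = A" and n: "2 \<le> n"
    and x: "x \<in> carrier_vec n" and i: "i < n"
  shows "((1\<^sub>m n - h \<cdot>\<^sub>m laplacian (A - H_mat n)) *\<^sub>v x) $ i
    = x $ i - h * (laplacian A *\<^sub>v x) $ i + h / (real n - 1) * (x $ i - (\<Sum>j<n. x $ j) / real n)"
proof -
  note AH = minus_H_mat_carrier[of A n] and AHt = minus_H_mat_symmetric[OF A]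
  note L = laplacian_carrier[OF AH]
  have "((1\<^sub>m n - h \<cdot>\<^sub>m laplacian (A - H_mat n)) *\<^sub>v x) $ i
      = x $ i - h * (laplacian (A - H_mat n) *\<^sub>v x) $ i"
    using L x i by (subst minus_mult_distrib_mat_vec[of _ n n]) (auto simp: smult_mat_mult_vec)
  \<comment> \<open>The zero diagonal of \<open>H_mat n\<close> may be replaced by
    \<open>1 / (n * (n - 1))\<close>, since the difference \<open>x $ i - x $ j\<close> vanishes
    there.\<close>
  also have "(laplacian (A - H_mat n) *\<^sub>v x) $ i
      = (\<Sum>j<n. A $$ (i, j) * (x $ i - x $ j) - (x $ i - x $ j) / (real n * (real n - 1)))"
    unfolding laplacian_mult_vec[OF AH AHt x i]
    using A i by (intro sum.cong) (auto simp: H_mat_def left_diff_distrib)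
  also have "\<dots> = (laplacian A *\<^sub>v x) $ i
      - (real n * x $ i - (\<Sum>j<n. x $ j)) / (real n * (real n - 1))"
    unfolding laplacian_mult_vec[OF A x i] by (simp add: sum_subtractf flip: sum_divide_distrib)
  finally show ?thesis using n by (simp add: field_simps)
qed

text \<open>Swapping the two summation indices turns the double sum into its own negative.\<close>

lemma sum_laplacian_mult_vec:
  assumes A: "A \<in> carrier_mat n n" "A\<^sup>T = A" and x: "x \<in> carrier_vec n"
  shows "(\<Sum>i<n. (laplacian A *\<^sub>v x) $ i) = 0"
proof -
  let ?S = "\<Sum>i<n. \<Sum>j<n. A $$ (i, j) * (x $ i - x $ j)"
  have "?S = (\<Sum>i<n. \<Sum>j<n. A $$ (j, i) * (x $ j - x $ i))" by (rule sum.swap)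
  also have "\<dots> = (\<Sum>i<n. \<Sum>j<n. - (A $$ (i, j) * (x $ i - x $ j)))"
    using symmetric_index[OF A] by (intro sum.cong) (auto simp: algebra_simps)
  also have "\<dots> = - ?S" by (simp add: sum_negf)
  finally have "?S = 0" by simp
  then show ?thesis using laplacian_mult_vec[OF A x] by simp
qed

text \<open>Estimate for a fixed \<open>n\<close>, from which the limit follows. The index 2 stands
  for \<open>R + 1\<close> with \<open>R = 1\<close>. The main work is to bound the spectrum of
  \<open>M - J\<close>.\<close>

lemma exaggeration_error_bound:
  fixes A :: "real mat" and h \<kappa> :: real
  assumes A: "A \<in> carrier_mat n n" "A\<^sup>T = A" and n: "2 \<le> n"
    and pos: "\<And>i j. i < n \<Longrightarrow> j < n \<Longrightarrow> i \<noteq> j \<Longrightarrow> 0 < A $$ (i, j)"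
    and h: "0 < h" "h / (real n - 1) \<le> \<kappa> / 2" and \<kappa>: "0 < \<kappa>" "\<kappa> < 1"
    and lower: "\<kappa> < h * nth_eigenvalue 2 (laplacian A)"
    and upper: "h * nth_eigenvalue n (laplacian A) < 1"
    and k: "0 < k" and y: "y \<in> carrier_vec n"
  shows "l2norm ((1\<^sub>m n - h \<cdot>\<^sub>m laplacian (A - H_mat n)) ^\<^sub>m k *\<^sub>v y
      - mat n n (\<lambda>_. 1 / real n) *\<^sub>v y) \<le> (1 - \<kappa> / 2) ^ k * l2norm y"
proof -
  define J :: "real mat" where "J = mat n n (\<lambda>_. 1 / real n)"
  define M where "M = 1\<^sub>m n - h \<cdot>\<^sub>m laplacian (A - H_mat n)"
  let ?L = "laplacian A"
  note AH = minus_H_mat_carrier[of A n] and AHt = minus_H_mat_symmetric[OF A]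
  have J: "J \<in> carrier_mat n n" "J\<^sup>T = J"
    unfolding J_def by (auto intro: symmetricI)
  have M: "M \<in> carrier_mat n n" unfolding M_def using laplacian_carrier[OF AH]
    by (intro minus_carrier_mat smult_carrier_mat)
  have Mt: "M\<^sup>T = M"
    using laplacian_carrier[OF AH]
      symmetric_index[OF laplacian_carrier[OF AH] laplacian_symmetric[OF AH AHt]]
    by (intro symmetricI[OF M]) (simp add: M_def)
  have MJc: "M - J \<in> carrier_mat n n" using J(1) by (rule minus_carrier_mat)
  have MJt: "(M - J)\<^sup>T = M - J"
    using J symmetric_index[OF J] symmetric_index[OF M Mt] M by (intro symmetricI[OF MJc]) simp
  have L: "?L \<in> carrier_mat n n" "?L\<^sup>T = ?L"
    using laplacian_carrier laplacian_symmetric A by auto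
  \<comment> \<open>The columns of \<open>J\<close> are constant: the Laplacian kills them and they
    equal their own mean, so \<open>M\<close> fixes them.\<close>
  have MJ: "M * J = J"
  proof (rule eq_matI)
    fix i j assume "i < dim_row J" "j < dim_col J"
    then have ij: "i < n" "j < n" using J by auto
    have c: "col J j \<in> carrier_vec n" using J(1) by (rule col_carrier_vec[OF ij(2)])
    have e: "col J j $ l = 1 / real n" if "l < n" for l using that ij J by (simp add: J_def)
    have "(?L *\<^sub>v col J j) $ i = 0"
      unfolding laplacian_mult_vec[OF A c ij(1)] using e ij by (intro sum.neutral) auto
    then have "(M *\<^sub>v col J j) $ i = col J j $ i"
      unfolding M_def exaggeration_mult_vec[OF A n c ij(1)] using e ij n by simp
    then show "(M * J) $$ (i, j) = J $$ (i, j)" using ij M J by simp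
  qed (use M J in auto)
  have JM: "J * M = J"
    using transpose_mult[OF M J(1)] MJ Mt J(2) by metis
  have JJ: "J * J = J"
    using n unfolding J_def by (intro eq_matI) (auto simp: scalar_prod_def)
  have zero: "eigenvalue ?L 0"
  proof -
    have v: "vec n (\<lambda>_. 1) \<in> carrier_vec n" by simp
    have "?L *\<^sub>v vec n (\<lambda>_. 1) = 0 \<cdot>\<^sub>v vec n (\<lambda>_. 1)"
      using L(1) by (intro eq_vecI)
        (auto simp: laplacian_mult_vec[OF A v] simp del: index_mult_mat_vec)
    moreover have "vec n (\<lambda>_. 1 :: real) \<noteq> 0\<^sub>v n"
      using n by (metis index_vec index_zero_vec(1) less_le_trans zero_less_numeral zero_neq_one)
    ultimately show ?thesis
      unfolding eigenvalue_def eigenvector_def using L(1) by (intro exI[of _ "vec n (\<lambda>_. 1)"]) auto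
  qed
  have ev: "\<bar>e\<bar> < 1 - \<kappa> / 2" if "eigenvalue (M - J) e" for e
  proof (cases "e = 0")
    case True
    then show ?thesis using \<kappa> by simp
  next
    case False
    obtain x where x: "x \<in> carrier_vec n" "x \<noteq> 0\<^sub>v n" "(M - J) *\<^sub>v x = e \<cdot>\<^sub>v x"
      using \<open>eigenvalue (M - J) e\<close> MJc unfolding eigenvalue_def eigenvector_def by auto
    define s where "s = (\<Sum>j<n. x $ j)"
    have eq: "e * x $ i = x $ i - h * (?L *\<^sub>v x) $ i + h / (real n - 1) * (x $ i - s / real n) - s / real n"
      if i: "i < n" for i
    proof -
      have "e * x $ i = ((M - J) *\<^sub>v x) $ i" using x i by simp
      also have "\<dots> = (M *\<^sub>v x) $ i - (J *\<^sub>v x) $ i"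
        using i M J x(1) by (simp add: minus_mult_distrib_mat_vec[of _ n n] del: index_mult_mat_vec)
      also have "(J *\<^sub>v x) $ i = s / real n"
        unfolding mult_mat_vec_index[OF J(1) x(1) i] using i
        by (simp add: J_def s_def sum_divide_distrib)
      finally show ?thesis
        unfolding M_def exaggeration_mult_vec[OF A n x(1) i] s_def .
    qed
    \<comment> \<open>Summing the coordinate equations removes the Laplacian and the deviation from
      the mean; the remaining \<open>s\<close> cancels against the contribution of \<open>J\<close>.
      Hence \<open>x\<close> is orthogonal to the constants.\<close>
    have "e * s = (\<Sum>i<n. e * x $ i)" unfolding s_def by (simp add: sum_distrib_left)
    also have "\<dots> = (\<Sum>i<n. x $ i - h * (?L *\<^sub>v x) $ i
        + h / (real n - 1) * (x $ i - s / real n) - s / real n)"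
      using eq by simp
    also have "\<dots> = s - h * (\<Sum>i<n. (?L *\<^sub>v x) $ i)
        + h / (real n - 1) * (s - real n * (s / real n)) - real n * (s / real n)"
      by (simp only: sum.distrib sum_subtractf sum_distrib_left[symmetric] sum_constant
          card_lessThan s_def[symmetric])
    also have "\<dots> = 0" using sum_laplacian_mult_vec[OF A x(1)] n by simp
    finally have s: "s = 0" using False by simp
    \<comment> \<open>This value solves the eigenvector equation, with \<open>s = 0\<close>, for the
      Laplacian term.\<close>
    define \<mu> where "\<mu> = (1 + h / (real n - 1) - e) / h"
    have Lx: "?L *\<^sub>v x = \<mu> \<cdot>\<^sub>v x"
    proof (rule eq_vecI)
      fix i assume "i < dim_vec (\<mu> \<cdot>\<^sub>v x)"
      then have i: "i < n" using x by simp
      have "h * (?L *\<^sub>v x) $ i = (1 + h / (real n - 1) - e) * x $ i"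
        using eq[OF i] unfolding s by (simp add: algebra_simps)
      then have "(?L *\<^sub>v x) $ i = \<mu> * x $ i" using h(1) by (simp add: \<mu>_def field_simps)
      then show "(?L *\<^sub>v x) $ i = (\<mu> \<cdot>\<^sub>v x) $ i" using i x by simp
    qed (use L x in simp)
    \<comment> \<open>For \<open>\<mu> = 0\<close> the maximum principle makes \<open>x\<close>
      constant, and its zero sum then makes it vanish.\<close>
    have "\<mu> \<noteq> 0"
    proof
      assume "\<mu> = 0"
      then have Lx0: "?L *\<^sub>v x = 0\<^sub>v n" using Lx x(1) by auto
      have const: "x $ i = x $ 0" if "i < n" for i
        by (rule laplacian_kernel_const[OF A pos x(1) Lx0 that]) (use n in simp_all)
      have "s = (\<Sum>j<n. x $ 0)" unfolding s_def by (intro sum.cong refl const) simp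
      then have "x $ 0 = 0" using s n by simp
      then have "x $ i = 0" if "i < n" for i using const[OF that] by simp
      then show False using x(1,2) by auto
    qed
    moreover have "eigenvalue ?L \<mu>"
      unfolding eigenvalue_def eigenvector_def using Lx x L by auto
    moreover have "0 < nth_eigenvalue 2 ?L"
      using lower h(1) \<kappa>(1) by (smt (verit) mult_nonneg_nonpos)
    ultimately have "nth_eigenvalue 2 ?L \<le> \<mu>" "\<mu> \<le> nth_eigenvalue n ?L"
      using symmetric_nonzero_eigenvalue_bounds[OF L zero] by auto
    then have "\<kappa> < h * \<mu>" "h * \<mu> < 1"
      using lower upper h(1) by (smt (verit) mult_left_mono)+
    \<comment> \<open>The perturbation \<open>h / (n - 1)\<close> uses up at most half of the gap
      \<open>\<kappa>\<close>, which leaves \<open>e < 1 - \<kappa> / 2\<close>;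
      \<open>h * \<mu> < 1\<close> keeps \<open>e\<close> positive.\<close>
    moreover have "e = 1 + h / (real n - 1) - h * \<mu>" using h(1) by (simp add: \<mu>_def)
    moreover have "0 \<le> h / (real n - 1)" using h n by simp
    ultimately show ?thesis using h(2) by linarith
  qed
  obtain m where m: "k = Suc m" using k by (cases k) auto
  have "M ^\<^sub>m k *\<^sub>v y - J *\<^sub>v y = (M ^\<^sub>m k - J) *\<^sub>v y"
    using M J y by (simp add: minus_mult_distrib_mat_vec[of _ n n])
  also have "\<dots> = (M - J) ^\<^sub>m k *\<^sub>v y"
    unfolding m deflation_pow[OF M J(1) MJ JM JJ] ..
  finally show ?thesis
    using symmetric_pow_contraction[OF MJc MJt ev _ y, of k] \<kappa> unfolding M_def J_def by simp
qed

section \<open>Passage to the limit\<close>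

theorem theorem5:
  fixes p :: "nat \<Rightarrow> nat"
    and X :: "nat \<Rightarrow> nat \<Rightarrow> real vec"
    and \<tau> :: "nat \<Rightarrow> nat \<Rightarrow> real"
    and P U :: "nat \<Rightarrow> real mat"
    and R k :: "nat \<Rightarrow> nat"
    and \<alpha> h :: "nat \<Rightarrow> real"
    and \<kappa> :: real
    and y :: "nat \<Rightarrow> real vec"
  assumes X: "\<And>n i. n \<ge> 2 \<Longrightarrow> i < n \<Longrightarrow> X n i \<in> carrier_vec (p n)"
    and \<tau>: "\<And>n i. n \<ge> 2 \<Longrightarrow> i < n \<Longrightarrow> \<tau> n i > 0"
    and P: "\<And>n. n \<ge> 2 \<Longrightarrow> P n = tsne_sim n (X n) (\<tau> n)"
    and R: "\<And>n. n \<ge> 2 \<Longrightarrow> R n = kernel_dim (laplacian (P n))"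
    and R_ge_1: "\<And>n. n \<ge> 2 \<Longrightarrow> R n \<ge> 1"
    and U: "\<And>n. n \<ge> 2 \<Longrightarrow> orthonormal_null_basis n (R n) (laplacian (P n)) (U n)"
    and \<alpha>: "\<And>n. n \<ge> 2 \<Longrightarrow> \<alpha> n > 0"
    and h: "\<And>n. n \<ge> 2 \<Longrightarrow> h n > 0"
    and \<kappa>: "0 < \<kappa>" "\<kappa> < 1"
    and lower: "\<And>n. n \<ge> 2 \<Longrightarrow> \<kappa> < h n * nth_eigenvalue (R n + 1) (laplacian (\<alpha> n \<cdot>\<^sub>m P n))"
    and middle: "\<And>n. n \<ge> 2 \<Longrightarrow>
      h n * nth_eigenvalue (R n + 1) (laplacian (\<alpha> n \<cdot>\<^sub>m P n))
        \<le> h n * nth_eigenvalue n (laplacian (\<alpha> n \<cdot>\<^sub>m P n))"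
    and upper: "\<And>n. n \<ge> 2 \<Longrightarrow> h n * nth_eigenvalue n (laplacian (\<alpha> n \<cdot>\<^sub>m P n)) < 1"
    and k_lim: "filterlim k at_top sequentially"
    and kh: "(\<lambda>n. real (k n) * h n / real n) \<longlonglongrightarrow> 0"
    and y: "\<And>n. n \<ge> 2 \<Longrightarrow> y n \<in> carrier_vec n"
    and y_nonzero: "\<And>n. n \<ge> 2 \<Longrightarrow> y n \<noteq> 0\<^sub>v n"
  shows "(\<lambda>n. l2norm
            (((1\<^sub>m n - h n \<cdot>\<^sub>m laplacian (\<alpha> n \<cdot>\<^sub>m P n - H_mat n)) ^\<^sub>m k n) *\<^sub>v y n
              - (U n * (U n)\<^sup>T) *\<^sub>v y n)
          / l2norm (y n)) \<longlonglongrightarrow> 0" (is "?err \<longlonglongrightarrow> 0")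
proof (rule tendsto_sandwich[where f = "\<lambda>_. 0" and h = "\<lambda>n. (1 - \<kappa> / 2) ^ k n"])
  show "(\<lambda>n. (1 - \<kappa> / 2) ^ k n) \<longlonglongrightarrow> 0"
    using \<kappa> by (intro filterlim_compose[OF LIMSEQ_realpow_zero k_lim]) auto
  show "\<forall>\<^sub>F n in sequentially. 0 \<le> ?err n"
    by (simp add: l2norm_nonneg)
  \<comment> \<open>The threshold is \<open>\<kappa> / 4\<close> because replacing
    \<open>n - 1\<close> by \<open>n\<close> in the denominator costs a factor of at most 2 for
    \<open>n \<ge> 2\<close>.\<close>
  have "\<forall>\<^sub>F n in sequentially. real (k n) * h n / real n < \<kappa> / 4"
    using kh \<kappa>(1) by (intro order_tendstoD(2)) auto
  moreover have "\<forall>\<^sub>F n in sequentially. 1 \<le> k n"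
    using k_lim by (simp add: filterlim_at_top)
  moreover have "\<forall>\<^sub>F n in sequentially. 2 \<le> n"
    by (rule eventually_ge_at_top)
  ultimately show "\<forall>\<^sub>F n in sequentially. ?err n \<le> (1 - \<kappa> / 2) ^ k n"
  proof eventually_elim
    case (elim n)
    note n = \<open>2 \<le> n\<close>
    let ?A = "\<alpha> n \<cdot>\<^sub>m P n"
    have Pc: "P n \<in> carrier_mat n n" "(P n)\<^sup>T = P n"
      using P[OF n] tsne_sim_carrier tsne_sim_symmetric by auto
    have P_pos: "0 < P n $$ (i, j)" if "i < n" "j < n" "i \<noteq> j" for i j
      using P[OF n] tsne_sim_pos that by simp
    have A: "?A \<in> carrier_mat n n" using Pc by simp
    have At: "?A\<^sup>T = ?A"
      using Pc symmetric_index[OF Pc] by (intro symmetricI[OF A]) simp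
    have A_pos: "0 < ?A $$ (i, j)" if "i < n" "j < n" "i \<noteq> j" for i j
      using P_pos[OF that] \<alpha>[OF n] Pc that by simp
    have "0 < n" using n by simp
    note LP = laplacian_carrier[OF Pc(1)]
    \<comment> \<open>The null space is that of the unscaled \<open>P n\<close>, to which
      \<open>U n\<close> refers; the eigenvalue bounds concern \<open>?A\<close>.\<close>
    have const: "x $ i = x $ j"
      if "x \<in> carrier_vec n" "laplacian (P n) *\<^sub>v x = 0\<^sub>v n" "i < n" "j < n" for x i j
      by (rule laplacian_kernel_const[OF Pc P_pos that])
    have R1: "R n = 1"
      by (rule orthonormal_null_basis_const(1)[OF LP \<open>0 < n\<close> R_ge_1[OF n] U[OF n] const])
    have UU: "U n * (U n)\<^sup>T = mat n n (\<lambda>_. 1 / real n)"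
      by (rule orthonormal_null_basis_const(2)[OF LP \<open>0 < n\<close> R_ge_1[OF n] U[OF n] const])
    have "h n / (real n - 1) \<le> 2 * (h n / real n)"
      using n h[OF n] by (simp add: field_simps)
    \<comment> \<open>Here \<open>k n \<ge> 1\<close> lets the assumption on
      \<open>k n * h n / n\<close> control \<open>h n / n\<close> alone.\<close>
    also have "h n / real n \<le> real (k n) * h n / real n"
      using \<open>1 \<le> k n\<close> h[OF n] by (intro divide_right_mono) auto
    also have "2 * (real (k n) * h n / real n) \<le> \<kappa> / 2"
      using elim(1) by linarith
    finally have hn: "h n / (real n - 1) \<le> \<kappa> / 2" by simp
    have low: "\<kappa> < h n * nth_eigenvalue 2 (laplacian ?A)"
      using lower[OF n] unfolding R1 one_add_one .
    have "0 < k n" using \<open>1 \<le> k n\<close> by simp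
    have "l2norm (((1\<^sub>m n - h n \<cdot>\<^sub>m laplacian (?A - H_mat n)) ^\<^sub>m k n) *\<^sub>v y n
        - (U n * (U n)\<^sup>T) *\<^sub>v y n) \<le> (1 - \<kappa> / 2) ^ k n * l2norm (y n)"
      unfolding UU
      by (rule exaggeration_error_bound[OF A At n A_pos h[OF n] hn \<kappa> low upper[OF n] \<open>0 < k n\<close> y[OF n]])
    then show ?case
      using l2norm_pos[OF y[OF n] y_nonzero[OF n]] by (simp add: divide_simps)
  qed
qed simp

end
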